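(* Let $a \in \mathbb{R}$ and let $f \colon [a,\infty) \to \mathbb{R}$ be a function such that, for some $\alpha \in (0,1)$, $f \in C_a^{\alpha}([a,\infty),\mathbb{R})$, i.e. $f$ is $\alpha$-differentiable at every point of $[a,\infty)$ (including the lower terminal $a$). Then for every $t_0 \in (a,\infty)$ $$I^{\alpha}_a\,T^{\alpha}_a f(t_0) = f(t_0) - f(a).$$
   Context: Let $a\in\mathbb{R}$ (the lower terminal) and $f\colon[a,\infty)\to\mathbb{R}$. The conformable derivative $T_a^\alpha f$ of order $\alpha\in(0,1]$ is defined as follows. (1) For $t\in(a,\infty)$: $T^{\alpha}_a f(t) = \lim_{\theta \to 0}\frac{f(t+\theta(t-a)^{1-\alpha}) - f(t)}{\theta}$, if the (finite) limit exists. (2) At $t=a$: $T_a^\alpha f(a)$ exists if and only if the right first derivative $f'(a)$ of $f$ at $a$ exists, and then $T_a^1 f(a)=f'(a)$, while $T_a^\alpha f(a)=0$ for $\alpha\in(0,1)$. $f$ is called $\alpha$-differentiable at a point if $T_a^\alpha f$ exists at that point. For an interval $J\subset[a,\infty)$, $f\in C_a^\alpha(J,\mathbb{R})$ means that $f$ is $\alpha$-differentiable at every point of $J$. The conformable integral of order $\alpha\in(0,1]$ with lower terminal $a$ of a function $h$ is, for $t>a$, $I_a^\alpha h(t)=\int_a^t (s-a)^{\alpha-1}h(s)\,ds$, where the integral is the usual Riemann improper integral.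
   Formalization: The integral need not exist as an improper Riemann integral (Volterra-type f); the equality is proved for Henstock–Kurzweil integrals, and for Riemann integrals when the integrand is Riemann integrable on [c,t_0] for all a<c<t_0. *)

theory Defs
  imports "HOL-Analysis.Analysis"
begin

text \<open>
  A function \<open>f\<close> on \<open>[a, \<infinity>)\<close> is a total function on the reals of which only
  the values on \<open>{a..}\<close> matter: for \<open>t > a\<close> and small \<open>\<theta>\<close> the point
  \<open>t + \<theta> (t - a) powr (1 - \<alpha>)\<close> lies in \<open>(a, \<infinity>)\<close>, and at \<open>t = a\<close>
  the derivative is taken from the right.
\<close>

definition has_conformable_derivative ::
    "real \<Rightarrow> real \<Rightarrow> (real \<Rightarrow> real) \<Rightarrow> real \<Rightarrow> real \<Rightarrow> bool" where
  "has_conformable_derivative a \<alpha> f D t \<longleftrightarrow>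
     (a < t \<and>
        ((\<lambda>\<theta>. (f (t + \<theta> * (t - a) powr (1 - \<alpha>)) - f t) / \<theta>) \<longlongrightarrow> D) (at 0)) \<or>
     (t = a \<and>
        (\<exists>d. (f has_real_derivative d) (at_right a) \<and> D = (if \<alpha> = 1 then d else 0)))"

definition conformable_differentiable :: "real \<Rightarrow> real \<Rightarrow> (real \<Rightarrow> real) \<Rightarrow> real \<Rightarrow> bool" where
  "conformable_differentiable a \<alpha> f t \<longleftrightarrow> (\<exists>D. has_conformable_derivative a \<alpha> f D t)"

definition conformable_deriv :: "real \<Rightarrow> real \<Rightarrow> (real \<Rightarrow> real) \<Rightarrow> real \<Rightarrow> real" where
  "conformable_deriv a \<alpha> f t = (THE D. has_conformable_derivative a \<alpha> f D t)"

definition conformable_differentiable_on ::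
    "real \<Rightarrow> real \<Rightarrow> (real \<Rightarrow> real) \<Rightarrow> real set \<Rightarrow> bool" where
  "conformable_differentiable_on a \<alpha> f J \<longleftrightarrow> (\<forall>t\<in>J. conformable_differentiable a \<alpha> f t)"

text \<open>
  The library's \<open>has_integral\<close> is the Henstock-Kurzweil integral, whose gauge may
  vary from point to point. The classical Riemann integral bounds the mesh of the
  tagged division uniformly; \<open>measure lborel K\<close> is the length of the subinterval \<open>K\<close>.
\<close>

definition has_riemann_integral :: "(real \<Rightarrow> real) \<Rightarrow> real \<Rightarrow> real set \<Rightarrow> bool" where
  "has_riemann_integral g y S \<longleftrightarrow>
     (\<forall>\<epsilon>>0. \<exists>\<delta>>0. \<forall>\<D>. \<D> tagged_division_of S \<and> (\<forall>(x, K)\<in>\<D>. measure lborel K < \<delta>) \<longrightarrow>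
        \<bar>(\<Sum>(x, K)\<in>\<D>. measure lborel K * g x) - y\<bar> < \<epsilon>)"

definition conformable_integrand :: "real \<Rightarrow> real \<Rightarrow> (real \<Rightarrow> real) \<Rightarrow> real \<Rightarrow> real" where
  "conformable_integrand a \<alpha> h s = (s - a) powr (\<alpha> - 1) * h s"

text \<open>
  The integral over \<open>[a, t]\<close>, improper at \<open>a\<close>. The proper integrals over
  \<open>[c, t]\<close>, \<open>a < c < t\<close>, are taken in the sense of the relation \<open>R\<close>, which is
  instantiated with \<open>has_riemann_integral\<close> or with \<open>has_integral\<close>.
\<close>

definition has_conformable_integral ::
    "((real \<Rightarrow> real) \<Rightarrow> real \<Rightarrow> real set \<Rightarrow> bool) \<Rightarrow>
     real \<Rightarrow> real \<Rightarrow> (real \<Rightarrow> real) \<Rightarrow> real \<Rightarrow> real \<Rightarrow> bool" where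
  "has_conformable_integral R a \<alpha> h t x \<longleftrightarrow>
     (\<exists>F. (\<forall>c\<in>{a<..<t}. R (conformable_integrand a \<alpha> h) (F c) {c..t}) \<and>
          (F \<longlongrightarrow> x) (at_right a))"

end

theory Submission
  imports Defs
begin

text \<open>For t > a the substitution h = \<theta> k with the fixed factor k = (t - a) powr (1 -
  \<alpha>) turns the conformable quotient into the ordinary one, so f is differentiable at t and
  f'(t) is exactly the integrand \<open>conformable_integrand\<close>
  (\<open>has_conformable_derivative_imp_has_real_derivative\<close>). The Henstock-Kurzweil form of
  the fundamental theorem integrates every derivative, hence the integral over [c, t0] is f(t0) -
  f(c) whenever a < c < t0. Differentiability at the terminal makes f right-continuous at a, and c
  -> a+ gives f(t0) - f(a).

  A derivative need not be Riemann integrable, so the Riemann half takes integrability on each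
  [c, t0] as a premise. A Riemann integral is also a gauge integral
  (\<open>has_riemann_integral_imp_has_integral\<close>), and uniqueness of the latter forces the
  same value f(t0) - f(c).\<close>

lemma conformable_deriv_eqI:
  assumes "has_conformable_derivative a \<alpha> f D t" and "a < t"
  shows "conformable_deriv a \<alpha> f t = D"
  unfolding conformable_deriv_def
proof (rule the_equality)
  show "E = D" if "has_conformable_derivative a \<alpha> f E t" for E
    using assms that unfolding has_conformable_derivative_def
    by (auto intro: tendsto_unique[OF at_neq_bot])
qed (fact assms(1))

lemma has_conformable_derivative_imp_has_real_derivative:
  assumes "has_conformable_derivative a \<alpha> f D t" and "a < t"
  shows "(f has_real_derivative (t - a) powr (\<alpha> - 1) * D) (at t)"
proof -
  define k where "k = (t - a) powr (1 - \<alpha>)"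
  have k: "k > 0" using assms(2) by (simp add: k_def)
  have lim: "((\<lambda>\<theta>. (f (t + \<theta> * k) - f t) / \<theta>) \<longlongrightarrow> D) (at 0)"
    using assms unfolding has_conformable_derivative_def k_def by auto
  have "((\<lambda>h. h / k) \<longlongrightarrow> 0 / k) (at 0)"
    using k by (intro tendsto_intros) auto
  \<comment> \<open>Since k is nonzero, h / k tends to 0 without taking the value 0 for h \<noteq>
    0; this allows \<theta> = h / k in the punctured limit.\<close>
  then have "filterlim (\<lambda>h. h / k) (at 0) (at 0)"
    using k by (auto simp: filterlim_at eventually_at intro: exI[of _ 1])
  from filterlim_compose[OF lim this]
  have "((\<lambda>h. (f (t + h) - f t) / (h / k)) \<longlongrightarrow> D) (at 0)"
    using k by simp
  from tendsto_divide[OF this tendsto_const[of k]]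
  have "((\<lambda>h. (f (t + h) - f t) / h) \<longlongrightarrow> D / k) (at 0)"
    using k by simp
  moreover have "D / k = (t - a) powr (\<alpha> - 1) * D"
    using powr_minus_divide[of "t - a" "1 - \<alpha>"] by (simp add: k_def)
  ultimately show ?thesis by (simp add: DERIV_def)
qed

text \<open>For \<alpha> < 1 the value D = 0 at the terminal is a convention and says nothing about
  f; the information lies in the existence of the right derivative, which gives right
  continuity.\<close>

lemma has_conformable_derivative_terminal_imp_tendsto:
  assumes "has_conformable_derivative a \<alpha> f D a"
  shows "(f \<longlongrightarrow> f a) (at_right a)"
proof -
  obtain d where "(f has_real_derivative d) (at_right a)"
    using assms unfolding has_conformable_derivative_def by auto
  then show ?thesis
    using DERIV_continuous[of f d a "{a<..}"] by (simp add: continuous_within)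
qed

text \<open>A uniform mesh bound \<delta> is a special gauge: the ball of constant radius \<delta> /
  2 around each tag. Every division fine for it has mesh below \<delta>.\<close>

lemma has_riemann_integral_imp_has_integral:
  assumes "has_riemann_integral g y {c..t}"
  shows "(g has_integral y) {c..t}"
proof -
  have "\<exists>\<gamma>. gauge \<gamma> \<and> (\<forall>\<D>. \<D> tagged_division_of cbox c t \<and> \<gamma> fine \<D> \<longrightarrow>
          norm ((\<Sum>(x, K)\<in>\<D>. measure lborel K *\<^sub>R g x) - y) < \<epsilon>)" if pos: "\<epsilon> > 0" for \<epsilon>
  proof -
    obtain \<delta> where \<delta>: "\<delta> > 0"
      and close: "\<forall>\<D>. \<D> tagged_division_of {c..t} \<and> (\<forall>(x, K)\<in>\<D>. measure lborel K < \<delta>) \<longrightarrow>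
        \<bar>(\<Sum>(x, K)\<in>\<D>. measure lborel K * g x) - y\<bar> < \<epsilon>"
      using assms[unfolded has_riemann_integral_def, THEN spec, THEN mp, OF pos] by (elim exE conjE)
    have small: "measure lborel K < \<delta>"
      if div: "\<D> tagged_division_of {c..t}" and fine: "(\<lambda>x. ball x (\<delta> / 2)) fine \<D>"
        and mem: "(x, K) \<in> \<D>" for \<D> x K
    proof -
      have sub: "K \<subseteq> ball x (\<delta> / 2)" and "x \<in> K"
        using fineD[OF fine mem] tagged_division_ofD(2)[OF div mem] by simp_all
      obtain u v where K: "K = {u..v}"
        using tagged_division_ofD(4)[OF div mem] by (metis box_real(2))
      \<comment> \<open>The tag makes K nonempty, so both endpoints belong to K and its length is v
        - u; the open ball of radius \<delta> / 2 then yields a strict bound.\<close>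
      have "u \<le> v" using \<open>x \<in> K\<close> K by auto
      then have "u \<in> ball x (\<delta> / 2)" "v \<in> ball x (\<delta> / 2)"
        using sub K by (simp_all add: subset_iff del: mem_ball)
      then have "v - u < \<delta>"
        unfolding mem_ball dist_real_def by linarith
      then show ?thesis
        using K \<open>u \<le> v\<close> by simp
    qed
    have "gauge (\<lambda>x::real. ball x (\<delta> / 2))"
      using \<delta> by (simp add: gauge_def)
    moreover have "norm ((\<Sum>(x, K)\<in>\<D>. measure lborel K *\<^sub>R g x) - y) < \<epsilon>"
      if "\<D> tagged_division_of cbox c t" "(\<lambda>x. ball x (\<delta> / 2)) fine \<D>" for \<D>
    proof -
      have "\<D> tagged_division_of {c..t}" using that(1) by simp
      moreover from this have "\<forall>(x, K)\<in>\<D>. measure lborel K < \<delta>"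
        using small that(2) by blast
      ultimately show ?thesis
        using close[rule_format, of \<D>] by simp
    qed
    ultimately show ?thesis
      by (intro exI[of _ "\<lambda>x. ball x (\<delta> / 2)"] conjI allI impI) (assumption, elim conjE)
  qed
  then have "(g has_integral y) (cbox c t)"
    unfolding has_integral by (intro allI impI)
  then show ?thesis by simp
qed

theorem theorem5p5:
  fixes a \<alpha> t\<^sub>0 :: real and f :: "real \<Rightarrow> real"
  assumes "0 < \<alpha>" and "\<alpha> < 1"
    and "conformable_differentiable_on a \<alpha> f {a..}"
    and "a < t\<^sub>0"
  shows "has_conformable_integral (has_integral) a \<alpha> (conformable_deriv a \<alpha> f) t\<^sub>0 (f t\<^sub>0 - f a) \<and>
    ((\<forall>c\<in>{a<..<t\<^sub>0}. \<exists>y.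
        has_riemann_integral (conformable_integrand a \<alpha> (conformable_deriv a \<alpha> f)) y {c..t\<^sub>0}) \<longrightarrow>
      has_conformable_integral has_riemann_integral a \<alpha> (conformable_deriv a \<alpha> f) t\<^sub>0 (f t\<^sub>0 - f a))"
proof -
  define g where "g = conformable_integrand a \<alpha> (conformable_deriv a \<alpha> f)"
  have ex: "\<exists>D. has_conformable_derivative a \<alpha> f D t" if "a \<le> t" for t
    using assms(3) that
    by (auto simp: conformable_differentiable_on_def conformable_differentiable_def)
  have "(f has_real_derivative g t) (at t)" if "a < t" for t
  proof -
    obtain D where D: "has_conformable_derivative a \<alpha> f D t"
      using ex[of t] \<open>a < t\<close> by auto
    show ?thesis
      using has_conformable_derivative_imp_has_real_derivative[OF D that]
        conformable_deriv_eqI[OF D that]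
      by (simp add: g_def conformable_integrand_def)
  qed
  \<comment> \<open>Taking c > a keeps the whole closed interval inside the region where g is the
    two-sided derivative of f.\<close>
  then have "(f has_vector_derivative g t) (at t within {c..t\<^sub>0})" if "a < c" "t \<in> {c..t\<^sub>0}" for c t
    using that
    by (simp add: has_field_derivative_at_within flip: has_real_derivative_iff_has_vector_derivative)
  then have hk: "(g has_integral f t\<^sub>0 - f c) {c..t\<^sub>0}" if "a < c" "c < t\<^sub>0" for c
    using that by (intro fundamental_theorem_of_calculus) simp_all
  \<comment> \<open>Integrability supplies only some value y; as y is also the gauge integral, it
    equals f(t0) - f(c).\<close>
  have riemann: "has_riemann_integral g (f t\<^sub>0 - f c) {c..t\<^sub>0}"
    if "a < c" "c < t\<^sub>0" "has_riemann_integral g y {c..t\<^sub>0}" for c y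
    using that(3) has_integral_unique[OF has_riemann_integral_imp_has_integral[OF that(3)]
      hk[OF that(1,2)]]
    by simp
  have "(f \<longlongrightarrow> f a) (at_right a)"
    using ex[of a] has_conformable_derivative_terminal_imp_tendsto by auto
  then have lim: "((\<lambda>c. f t\<^sub>0 - f c) \<longlongrightarrow> f t\<^sub>0 - f a) (at_right a)"
    by (intro tendsto_intros)
  have "has_conformable_integral (has_integral) a \<alpha> (conformable_deriv a \<alpha> f) t\<^sub>0 (f t\<^sub>0 - f a)"
    unfolding has_conformable_integral_def g_def[symmetric]
    using hk lim by (intro exI[of _ "\<lambda>c. f t\<^sub>0 - f c"]) simp
  moreover have "has_conformable_integral has_riemann_integral a \<alpha> (conformable_deriv a \<alpha> f) t\<^sub>0 (f t\<^sub>0 - f a)"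
    if integrable: "\<forall>c\<in>{a<..<t\<^sub>0}. \<exists>y. has_riemann_integral g y {c..t\<^sub>0}"
    unfolding has_conformable_integral_def g_def[symmetric]
  proof (intro exI[of _ "\<lambda>c. f t\<^sub>0 - f c"] conjI ballI lim)
    fix c assume c: "c \<in> {a<..<t\<^sub>0}"
    then obtain y where "has_riemann_integral g y {c..t\<^sub>0}"
      using bspec[OF integrable] by blast
    with c show "has_riemann_integral g (f t\<^sub>0 - f c) {c..t\<^sub>0}"
      using riemann by simp
  qed
  ultimately show ?thesis
    unfolding g_def by (intro conjI impI)
qed

end
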